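(* Let $m\ge 2$ and let $(d_1,r_1)$ be an arithmetical structure on $P_m$, i.e. $\operatorname{diag}(d_1)\,r_1=A(P_m)\,r_1$ with $r_1\in\mathbb Z_{>0}^m$ primitive and $d_1\in\mathbb Z_{>0}^m$. Order the vertices of the ladder graph $P_2\square P_m$ as $(1,1),\dots,(1,m),(2,1),\dots,(2,m)$. Then arithmetical structures on $P_2\square P_m$ can be constructed as follows. (1) With $\mathbf 1=(1,\dots,1)\in\mathbb Z^m$, define $$\mathbf r=\begin{pmatrix} r_1\\ r_1\end{pmatrix},\qquad \mathbf d=\begin{pmatrix} d_1+\mathbf 1\\ d_1+\mathbf 1\end{pmatrix}.$$ Then $(\mathbf d,\mathbf r)$ is an arithmetical structure on $P_2\square P_m$. (2) Let $k\in\mathbb Z_{\ge 0}^m$, define $D_1=\operatorname{diag}(d_1+k)$, and set $r_2:=(D_1-A(P_m))\,r_1$. Suppose $r_2\in\mathbb Z_{>0}^m$ and that $(r_2)_i\mid (A(P_m)r_2+r_1)_i$ for every $1\le i\le m$. Define $d_2\in\mathbb Z_{>0}^m$ by $$(d_2)_i=\frac{(A(P_m)r_2+r_1)_i}{(r_2)_i},\qquad 1\le i\le m,$$ that is, $(D_2-A(P_m))r_2=r_1$ where $D_2=\operatorname{diag}(d_2)$. Then $$r=\begin{pmatrix} r_1\\ r_2\end{pmatrix},\qquad d=\begin{pmatrix} d_1+k\\ d_2\end{pmatrix}$$ is an arithmetical structure $(d,r)$ on $P_2\square P_m$.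
   Context: An arithmetical structure on a finite connected graph $G$ is a pair $(\mathbf d,\mathbf r)$ of vectors of positive integers indexed by the vertices of $G$ such that $\mathbf r$ is primitive (the gcd of its entries is $1$) and $(\operatorname{diag}(\mathbf d)-A(G))\mathbf r=0$, where $A(G)$ is the adjacency matrix of $G$. $P_n$ is the path graph with vertex set $\{1,\dots,n\}$ and edges $\{i,i+1\}$, $1\le i<n$. The Cartesian product $G_1\square G_2$ has vertex set $V(G_1)\times V(G_2)$, with $(u_1,v_1)$ adjacent to $(u_2,v_2)$ iff ($u_1=u_2$ and $v_1v_2\in E(G_2)$) or ($v_1=v_2$ and $u_1u_2\in E(G_1)$). *)

theory Defs
  imports "Jordan_Normal_Form.Matrix" "Graph_Theory.Graph_Theory"
begin

text \<open>
  A graph is a \<open>pair_pre_digraph\<close> satisfying the locale predicate \<open>pair_graph\<close> (finite, loopless,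
  symmetric set of arcs), so that the edge \<open>{u, v}\<close> is represented by the two arcs \<open>(u, v)\<close> and
  \<open>(v, u)\<close>.
\<close>

definition path_graph :: "nat \<Rightarrow> nat pair_pre_digraph" where
  "path_graph n = \<lparr> pverts = {1..n},
     parcs = {(u, v). u \<in> {1..n} \<and> v \<in> {1..n} \<and> (v = u + 1 \<or> u = v + 1)} \<rparr>"

definition cartesian_product ::
  "'a pair_pre_digraph \<Rightarrow> 'b pair_pre_digraph \<Rightarrow> ('a \<times> 'b) pair_pre_digraph" (infixr \<open>\<box>\<close> 75) where
  "G \<box> H = \<lparr> pverts = pverts G \<times> pverts H,
     parcs = {((u1, v1), (u2, v2)).
       (u1, v1) \<in> pverts G \<times> pverts H \<and> (u2, v2) \<in> pverts G \<times> pverts H \<and>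
       ((u1 = u2 \<and> (v1, v2) \<in> parcs H) \<or> (v1 = v2 \<and> (u1, u2) \<in> parcs G))} \<rparr>"

text \<open>
  Vectors and matrices indexed by the vertices of a graph are taken with respect to an enumeration
  \<open>vs\<close> of the vertices: coordinate \<open>i\<close> (starting from \<open>0\<close>) belongs to the vertex \<open>vs ! i\<close>.
\<close>

definition adjacency_matrix :: "'a pair_pre_digraph \<Rightarrow> 'a list \<Rightarrow> int mat" where
  "adjacency_matrix G vs = mat (length vs) (length vs)
     (\<lambda>(i, j). if (vs ! i, vs ! j) \<in> parcs G then 1 else 0)"

definition diag_of_vec :: "int vec \<Rightarrow> int mat" where
  "diag_of_vec d = mat_diag (dim_vec d) (\<lambda>i. d $ i)"

definition positive_vec :: "int vec \<Rightarrow> bool" where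
  "positive_vec v \<longleftrightarrow> (\<forall>i<dim_vec v. 0 < v $ i)"

definition nonnegative_vec :: "int vec \<Rightarrow> bool" where
  "nonnegative_vec v \<longleftrightarrow> (\<forall>i<dim_vec v. 0 \<le> v $ i)"

definition primitive_vec :: "int vec \<Rightarrow> bool" where
  "primitive_vec v \<longleftrightarrow> Gcd (set\<^sub>v v) = 1"

definition arithmetical_structure ::
  "'a pair_pre_digraph \<Rightarrow> 'a list \<Rightarrow> int vec \<Rightarrow> int vec \<Rightarrow> bool" where
  "arithmetical_structure G vs d r \<longleftrightarrow>
     pair_graph G \<and> connected (with_proj G) \<and>
     distinct vs \<and> set vs = pverts G \<and>
     d \<in> carrier_vec (length vs) \<and> r \<in> carrier_vec (length vs) \<and>
     positive_vec d \<and> positive_vec r \<and> primitive_vec r \<and>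
     (diag_of_vec d - adjacency_matrix G vs) *\<^sub>v r = 0\<^sub>v (length vs)"

definition path_order :: "nat \<Rightarrow> nat list" where
  "path_order n = [1..<Suc n]"

text \<open>
  \<open>List.product\<close> enumerates lexicographically, so this is \<open>(1,1), \<dots>, (1,m), (2,1), \<dots>, (2,m)\<close>.
\<close>

definition ladder_order :: "nat \<Rightarrow> (nat \<times> nat) list" where
  "ladder_order m = List.product (path_order 2) (path_order m)"

text \<open>
  The graph conditions in \<open>arithmetical_structure\<close> hold for paths and are preserved by products.
\<close>

lemma pverts_path_graph [simp]: "pverts (path_graph n) = {1..n}"
  by (simp add: path_graph_def)

lemma pverts_cartesian_product [simp]: "pverts (G \<box> H) = pverts G \<times> pverts H"
  by (simp add: cartesian_product_def)

lemma pair_graph_path_graph: "pair_graph (path_graph n)"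
proof
  show "finite (parcs (path_graph n))"
    by (rule finite_subset[of _ "{1..n} \<times> {1..n}"]) (auto simp: path_graph_def)
  show "symmetric (with_proj (path_graph n))"
    by (auto simp: symmetric_def path_graph_def intro!: symI)
qed (auto simp: path_graph_def)

lemma pair_graph_cartesian_product:
  assumes "pair_graph G" "pair_graph H"
  shows "pair_graph (G \<box> H)"
proof -
  interpret G: pair_graph G by fact
  interpret H: pair_graph H by fact
  have sG: "sym (parcs G)" and sH: "sym (parcs H)"
    using G.pair_sym_arcs H.pair_sym_arcs by (auto simp: symmetric_def)
  show ?thesis
  proof
    show "finite (parcs (G \<box> H))"
      by (rule finite_subset[of _ "(pverts G \<times> pverts H) \<times> (pverts G \<times> pverts H)"])
        (auto simp: cartesian_product_def)
    show "symmetric (with_proj (G \<box> H))"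
      using sG sH by (auto simp: symmetric_def cartesian_product_def sym_def)
  qed (auto simp: cartesian_product_def dest: G.pair_no_loops H.pair_no_loops)
qed

lemma connected_pair_graph_iff:
  assumes "pair_graph G"
  shows "connected (with_proj G) \<longleftrightarrow>
    pverts G \<noteq> {} \<and> (\<forall>u\<in>pverts G. \<forall>v\<in>pverts G. u \<rightarrow>\<^sup>*\<^bsub>with_proj G\<^esub> v)"
proof -
  interpret pair_graph G by fact
  show ?thesis
    unfolding connected_def strongly_connected_def
    using reachable_mk_symmetric_eq[OF sym_arcs] by auto
qed

lemma connected_path_graph:
  assumes "n \<ge> 1"
  shows "connected (with_proj (path_graph n))"
proof -
  interpret pair_graph "path_graph n" by (rule pair_graph_path_graph)
  have 1: "1 \<rightarrow>\<^sup>*\<^bsub>with_proj (path_graph n)\<^esub> v" if "1 \<le> v" "v \<le> n" for v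
    using that
  proof (induction v rule: dec_induct)
    case base
    then show ?case using assms by (auto intro!: reachable_refl)
  next
    case (step v)
    then have "v \<rightarrow>\<^bsub>with_proj (path_graph n)\<^esub> Suc v" by (auto simp: path_graph_def)
    with step show ?case using reachable_adj_trans by simp
  qed
  have "u \<rightarrow>\<^sup>*\<^bsub>with_proj (path_graph n)\<^esub> v"
    if "u \<in> pverts (path_graph n)" "v \<in> pverts (path_graph n)" for u v
  proof (rule reachable_trans)
    show "u \<rightarrow>\<^sup>*\<^bsub>with_proj (path_graph n)\<^esub> 1"
      using that 1[of u] by (simp add: symmetric_reachable')
    show "1 \<rightarrow>\<^sup>*\<^bsub>with_proj (path_graph n)\<^esub> v"
      using that 1[of v] by simp
  qed
  then show ?thesis
    using assms by (auto simp: connected_pair_graph_iff[OF pair_graph_path_graph])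
qed

lemma connected_cartesian_product:
  assumes G: "pair_graph G" and H: "pair_graph H"
    and "connected (with_proj G)" "connected (with_proj H)"
  shows "connected (with_proj (G \<box> H))"
proof -
  interpret G: pair_graph G by fact
  interpret H: pair_graph H by fact
  interpret P: pair_graph "G \<box> H" using G H by (rule pair_graph_cartesian_product)
  have lift_G: "(u, w) \<rightarrow>\<^sup>*\<^bsub>with_proj (G \<box> H)\<^esub> (v, w)"
    if "u \<rightarrow>\<^sup>*\<^bsub>with_proj G\<^esub> v" "w \<in> pverts H" for u v w
    using that(1)
  proof (induction rule: G.reachable_induct)
    case base
    then show ?case using that(2) by (auto intro!: P.reachable_refl)
  next
    case (step x y)
    then have "(x, w) \<rightarrow>\<^bsub>with_proj (G \<box> H)\<^esub> (y, w)"
      using that(2) by (auto simp: cartesian_product_def dest: G.in_arcsD1 G.in_arcsD2)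
    with step show ?case using P.reachable_adj_trans by simp
  qed
  have lift_H: "(w, u) \<rightarrow>\<^sup>*\<^bsub>with_proj (G \<box> H)\<^esub> (w, v)"
    if "u \<rightarrow>\<^sup>*\<^bsub>with_proj H\<^esub> v" "w \<in> pverts G" for u v w
    using that(1)
  proof (induction rule: H.reachable_induct)
    case base
    then show ?case using that(2) by (auto intro!: P.reachable_refl)
  next
    case (step x y)
    then have "(w, x) \<rightarrow>\<^bsub>with_proj (G \<box> H)\<^esub> (w, y)"
      using that(2) by (auto simp: cartesian_product_def dest: H.in_arcsD1 H.in_arcsD2)
    with step show ?case using P.reachable_adj_trans by simp
  qed
  have "(u, w) \<rightarrow>\<^sup>*\<^bsub>with_proj (G \<box> H)\<^esub> (v, x)"
    if "u \<in> pverts G" "v \<in> pverts G" "w \<in> pverts H" "x \<in> pverts H" for u v w x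
  proof (rule P.reachable_trans)
    show "(u, w) \<rightarrow>\<^sup>*\<^bsub>with_proj (G \<box> H)\<^esub> (v, w)"
      using that assms(3) connected_pair_graph_iff[OF G] by (intro lift_G) auto
    show "(v, w) \<rightarrow>\<^sup>*\<^bsub>with_proj (G \<box> H)\<^esub> (v, x)"
      using that assms(4) connected_pair_graph_iff[OF H] by (intro lift_H) auto
  qed
  moreover have "pverts G \<noteq> {}" "pverts H \<noteq> {}"
    using assms(3,4) connected_pair_graph_iff[OF G] connected_pair_graph_iff[OF H] by blast+
  ultimately show ?thesis
    unfolding connected_pair_graph_iff[OF pair_graph_cartesian_product[OF G H]] by simp
qed

end

theory Submission
  imports Defs
begin

text \<open>
  Write \<open>A\<close> for the adjacency matrix of a graph \<open>H\<close> and enumerate the prism \<open>P\<^sub>2 \<box> H\<close> one copy of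
  \<open>H\<close> after the other. Each vertex has exactly one neighbour outside its own copy, namely its twin,
  so the matrix whose kernel must contain \<open>(x, y)\<close> is, for the diagonal \<open>(a, b)\<close>, the block matrix
  with diagonal blocks \<open>diag a - A\<close>, \<open>diag b - A\<close> and off-diagonal blocks \<open>-I\<close>
  (\<open>adjacency_matrix_prism\<close>, \<open>prism_laplacian_block\<close>). Hence the kernel condition on the prism is
  the pair of equations \<open>(diag a - A) x = y\<close> and \<open>(diag b - A) y = x\<close>, and primitivity of \<open>x\<close> forces that of \<open>(x, y)\<close>
  (\<open>arithmetical_structure_prism\<close>).

  Both constructions solve these two equations. If \<open>(diag d - A) r = 0\<close>, then adding \<open>1\<close> to every
  entry of \<open>d\<close> turns the right-hand side into \<open>r\<close>, so \<open>x = y = r\<close> works. In the second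
  construction the first equation is the definition of \<open>r\<^sub>2\<close>, and the second says
  that \<open>r\<^sub>2\<close> times the new diagonal is \<open>A r\<^sub>2 + r\<^sub>1\<close> in each coordinate; divisibility makes the
  quotient exact, and positivity of \<open>r\<^sub>1\<close> and \<open>r\<^sub>2\<close> makes it positive. A ladder is the case
  where \<open>H\<close> is a path.
\<close>

lemma diag_of_vec_minus_mult_vec:
  assumes "d \<in> carrier_vec n" "A \<in> carrier_mat n n" "v \<in> carrier_vec n"
  shows "(diag_of_vec d - A) *\<^sub>v v = vec n (\<lambda>i. d $ i * v $ i) - A *\<^sub>v v"
proof -
  have D: "diag_of_vec d \<in> carrier_mat n n"
    using assms(1) by (auto simp: diag_of_vec_def)
  have "diag_of_vec d *\<^sub>v v = vec n (\<lambda>i. d $ i * v $ i)"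
    using assms(1,3)
    by (intro eq_vecI)
      (auto simp: diag_of_vec_def mat_diag_def scalar_prod_def if_distrib[of "\<lambda>x. x * _"]
        if_distribR cong: if_cong)
  then show ?thesis
    using minus_mult_distrib_mat_vec[OF D assms(2,3)] by simp
qed

lemma adjacency_matrix_carrier:
  "adjacency_matrix G vs \<in> carrier_mat (length vs) (length vs)"
  by (simp add: adjacency_matrix_def)

lemma product_path_order_2:
  "List.product (path_order 2) vs = map (Pair 1) vs @ map (Pair 2) vs"
  by (simp add: path_order_def upt_rec numeral_2_eq_2)

text \<open>
  An arc of the prism either stays inside a copy of \<open>H\<close>, which gives the diagonal blocks, or joins
  a vertex to its twin in the other copy. As the enumeration is injective, the arcs of the second
  kind are exactly the positions \<open>(i, length vs + i)\<close> and \<open>(length vs + i, i)\<close>, which gives the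
  two identity blocks.
\<close>

lemma adjacency_matrix_prism:
  assumes "distinct vs" "set vs = pverts H"
  shows "adjacency_matrix (path_graph 2 \<box> H) (List.product (path_order 2) vs) =
    four_block_mat (adjacency_matrix H vs) (1\<^sub>m (length vs))
      (1\<^sub>m (length vs)) (adjacency_matrix H vs)"
    (is "?L = ?R")
proof (rule eq_matI)
  fix i j
  assume ij: "i < dim_row ?R" "j < dim_col ?R"
  let ?n = "length vs" and ?us = "List.product (path_order 2) vs"
  (* Position i belongs to the vertex at position ?p i of copy number ?c i. *)
  let ?p = "\<lambda>i. if i < ?n then i else i - ?n" and ?c = "\<lambda>i. if i < ?n then 1 else 2 :: nat"
  have ij': "i < ?n + ?n" "j < ?n + ?n" "?p i < ?n" "?p j < ?n"
    using ij by (auto simp: adjacency_matrix_def)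
  have us: "?us ! k = (?c k, vs ! ?p k)" if "k < ?n + ?n" for k
    using that by (simp add: product_path_order_2 nth_append)
  have vs: "vs ! ?p i \<in> pverts H" "vs ! ?p j \<in> pverts H"
    using ij'(3,4) assms(2) nth_mem by blast+
  have inj: "vs ! ?p i = vs ! ?p j \<longleftrightarrow> ?p i = ?p j"
    using ij'(3,4) assms(1) by (simp only: nth_eq_iff_index_eq)
  have arc: "(?us ! i, ?us ! j) \<in> parcs (path_graph 2 \<box> H) \<longleftrightarrow>
      (if ?c i = ?c j then (vs ! ?p i, vs ! ?p j) \<in> parcs H else ?p i = ?p j)"
    unfolding us[OF ij'(1)] us[OF ij'(2)] cartesian_product_def path_graph_def inj[symmetric]
    using vs by simp
  have "?L $$ (i, j) = (if (?us ! i, ?us ! j) \<in> parcs (path_graph 2 \<box> H) then 1 else 0)"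
    using ij'(1,2) by (simp add: adjacency_matrix_def product_path_order_2)
  also have "\<dots> = ?R $$ (i, j)"
    unfolding arc using ij'(1,2)
    by (cases "i < ?n"; cases "j < ?n") (simp_all add: adjacency_matrix_def)
  finally show "?L $$ (i, j) = ?R $$ (i, j)" .
qed (simp_all add: adjacency_matrix_def product_path_order_2)

lemma prism_laplacian_block:
  assumes "distinct vs" "set vs = pverts H"
    and "a \<in> carrier_vec (length vs)" "b \<in> carrier_vec (length vs)"
  shows "diag_of_vec (a @\<^sub>v b) -
      adjacency_matrix (path_graph 2 \<box> H) (List.product (path_order 2) vs) =
    four_block_mat (diag_of_vec a - adjacency_matrix H vs) (- 1\<^sub>m (length vs))
      (- 1\<^sub>m (length vs)) (diag_of_vec b - adjacency_matrix H vs)"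
  unfolding adjacency_matrix_prism[OF assms(1,2)]
  using assms(3,4) adjacency_matrix_carrier[of H vs]
  by (intro eq_matI) (auto simp: diag_of_vec_def mat_diag_def)

text \<open>
  By the block form, the product with \<open>(x, y)\<close> is \<open>((diag a - A) x - y, (diag b - A) y - x)\<close>, so
  the two hypotheses on \<open>x\<close> and \<open>y\<close> say precisely that it vanishes.
\<close>

lemma arithmetical_structure_prism:
  fixes a b x y :: "int vec"
  assumes H: "pair_graph H" "connected (with_proj H)" "distinct vs" "set vs = pverts H"
    and carr: "a \<in> carrier_vec (length vs)" "b \<in> carrier_vec (length vs)"
      "x \<in> carrier_vec (length vs)" "y \<in> carrier_vec (length vs)"
    and pos: "positive_vec a" "positive_vec b" "positive_vec x" "positive_vec y"
    and prim: "primitive_vec x"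
    and xy: "(diag_of_vec a - adjacency_matrix H vs) *\<^sub>v x = y"
    and yx: "(diag_of_vec b - adjacency_matrix H vs) *\<^sub>v y = x"
  shows "arithmetical_structure (path_graph 2 \<box> H) (List.product (path_order 2) vs)
    (a @\<^sub>v b) (x @\<^sub>v y)"
proof -
  let ?n = "length vs" and ?us = "List.product (path_order 2) vs"
  have len: "length ?us = ?n + ?n" by (simp add: product_path_order_2)
  have pair: "pair_graph (path_graph 2 \<box> H)"
    using pair_graph_path_graph H(1) by (rule pair_graph_cartesian_product)
  have con: "connected (with_proj (path_graph 2 \<box> H))"
    using pair_graph_path_graph H(1) connected_path_graph H(2)
    by (rule connected_cartesian_product) simp
  have dis: "distinct ?us" and set: "set ?us = pverts (path_graph 2 \<box> H)"
    using H(3,4) by (auto simp: path_order_def distinct_product)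
  have pos_app: "positive_vec (v @\<^sub>v w)" if "positive_vec v" "positive_vec w" for v w
    using that by (auto simp: positive_vec_def)
  (* The gcd of the entries of the longer vector divides that of x, which is 1. *)
  have "x $ i \<in> set\<^sub>v (x @\<^sub>v y)" if "i < dim_vec x" for i
    using that by (intro vec_setI[of "x @\<^sub>v y" i]) auto
  then have "set\<^sub>v x \<subseteq> set\<^sub>v (x @\<^sub>v y)"
    by (auto simp: vec_set_def[of x])
  then have "Gcd (set\<^sub>v (x @\<^sub>v y)) dvd Gcd (set\<^sub>v x)"
    by (intro Gcd_greatest) (auto intro: Gcd_dvd)
  with prim have prim': "primitive_vec (x @\<^sub>v y)"
    by (simp add: primitive_vec_def)
  have A: "diag_of_vec c - adjacency_matrix H vs \<in> carrier_mat ?n ?n" for c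
    by (auto simp: adjacency_matrix_def)
  have "(diag_of_vec (a @\<^sub>v b) - adjacency_matrix (path_graph 2 \<box> H) ?us) *\<^sub>v (x @\<^sub>v y) =
    (y + - 1\<^sub>m ?n *\<^sub>v y) @\<^sub>v (- 1\<^sub>m ?n *\<^sub>v x + x)"
    unfolding prism_laplacian_block[OF H(3,4) carr(1,2)]
    using four_block_mat_mult_vec[OF A _ _ A carr(3,4)] by (simp add: xy yx)
  also have "\<dots> = 0\<^sub>v (length ?us)"
    unfolding len using carr by (intro eq_vecI) auto
  finally show ?thesis
    unfolding arithmetical_structure_def
    using pair con dis set carr pos pos_app prim' len by auto
qed

text \<open>
  In the doubled labelling every vertex gains one neighbour with its own label, its twin; raising
  its \<open>d\<close>-value by \<open>1\<close> compensates for that.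
\<close>

lemma arithmetical_structure_prism_doubling:
  assumes "arithmetical_structure H vs d r"
  shows "arithmetical_structure (path_graph 2 \<box> H) (List.product (path_order 2) vs)
    ((d + vec (length vs) (\<lambda>_. 1)) @\<^sub>v (d + vec (length vs) (\<lambda>_. 1))) (r @\<^sub>v r)"
proof -
  let ?d' = "d + vec (length vs) (\<lambda>_. 1)" and ?A = "adjacency_matrix H vs"
  note S = assms[unfolded arithmetical_structure_def]
  have d: "d \<in> carrier_vec (length vs)" and r: "r \<in> carrier_vec (length vs)"
    using S by auto
  have d': "?d' \<in> carrier_vec (length vs)" using d by auto
  have "(diag_of_vec d - ?A) *\<^sub>v r = 0\<^sub>v (length vs)" using S by blast
  then have ker: "vec (length vs) (\<lambda>i. d $ i * r $ i) - ?A *\<^sub>v r = 0\<^sub>v (length vs)"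
    by (simp add: diag_of_vec_minus_mult_vec[OF d adjacency_matrix_carrier r])
  have "(diag_of_vec ?d' - ?A) *\<^sub>v r = vec (length vs) (\<lambda>i. ?d' $ i * r $ i) - ?A *\<^sub>v r"
    by (rule diag_of_vec_minus_mult_vec[OF d' adjacency_matrix_carrier r])
  also have "\<dots> = (vec (length vs) (\<lambda>i. d $ i * r $ i) - ?A *\<^sub>v r) + r"
    using d r adjacency_matrix_carrier[of H vs] by (intro eq_vecI) (auto simp: algebra_simps)
  also have "\<dots> = r" using r by (simp add: ker)
  finally have "(diag_of_vec ?d' - ?A) *\<^sub>v r = r" .
  moreover have "positive_vec ?d'" using S by (auto simp: positive_vec_def intro!: add_pos_pos)
  ultimately show ?thesis
    using S d' by (intro arithmetical_structure_prism) auto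
qed

lemma adjacency_matrix_mult_nonneg:
  assumes "v \<in> carrier_vec (length vs)" "positive_vec v" "i < length vs"
  shows "0 \<le> (adjacency_matrix G vs *\<^sub>v v) $ i"
  using assms
  by (auto simp: adjacency_matrix_def scalar_prod_def positive_vec_def less_imp_le
      intro!: sum_nonneg)

text \<open>
  The vector \<open>s\<close> is what the labels on the second copy must be for the balance on the first copy to
  hold. Balance at vertex \<open>i\<close> of the second copy, whose neighbours have labels adding up to
  \<open>(A s + r)\<^sub>i\<close>, then leaves only one candidate for its \<open>d\<close>-value, the quotient \<open>e\<^sub>i\<close>.
\<close>

lemma arithmetical_structure_prism_extension:
  assumes S: "arithmetical_structure H vs d r"
    and k: "k \<in> carrier_vec (length vs)" "nonnegative_vec k"
    and A: "A = adjacency_matrix H vs"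
    and s: "s = (diag_of_vec (d + k) - A) *\<^sub>v r" "positive_vec s"
    and dvd: "\<forall>i<length vs. s $ i dvd (A *\<^sub>v s + r) $ i"
    and e: "e = vec (length vs) (\<lambda>i. (A *\<^sub>v s + r) $ i div s $ i)"
  shows "positive_vec e \<and> (diag_of_vec e - A) *\<^sub>v s = r \<and>
    arithmetical_structure (path_graph 2 \<box> H) (List.product (path_order 2) vs)
      ((d + k) @\<^sub>v e) (r @\<^sub>v s)"
proof -
  note S' = S[unfolded arithmetical_structure_def]
  have d: "d \<in> carrier_vec (length vs)" and r: "r \<in> carrier_vec (length vs)"
    using S' by auto
  have Ac: "A \<in> carrier_mat (length vs) (length vs)"
    unfolding A by (rule adjacency_matrix_carrier)
  have sc: "s \<in> carrier_vec (length vs)" unfolding s(1) using Ac by (intro carrier_vecI) simp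
  have ec: "e \<in> carrier_vec (length vs)" by (simp add: e)
  have pos_num: "0 < (A *\<^sub>v s + r) $ i" if "i < length vs" for i
    using adjacency_matrix_mult_nonneg[OF sc s(2) that, of H] S' r that Ac
    by (auto simp: A positive_vec_def)
  have e_pos: "positive_vec e"
    unfolding positive_vec_def
  proof (intro allI impI)
    fix i assume "i < dim_vec e"
    then have i: "i < length vs" by (simp add: e)
    then have "0 < s $ i" using s(2) sc by (auto simp: positive_vec_def)
    with i dvd pos_num[OF i] have "0 < (A *\<^sub>v s + r) $ i div s $ i"
      by (simp add: pos_imp_zdiv_pos_iff zdvd_imp_le)
    then show "0 < e $ i" using i by (simp add: e)
  qed
  have "vec (length vs) (\<lambda>i. e $ i * s $ i) = A *\<^sub>v s + r"
    using dvd r Ac by (intro eq_vecI) (auto simp: e)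
  then have balance: "(diag_of_vec e - A) *\<^sub>v s = r"
    using diag_of_vec_minus_mult_vec[OF ec Ac sc] r Ac by (auto intro!: eq_vecI)
  have "positive_vec (d + k)"
    using S' k by (auto simp: positive_vec_def nonnegative_vec_def intro!: add_pos_nonneg)
  then have "arithmetical_structure (path_graph 2 \<box> H) (List.product (path_order 2) vs)
      ((d + k) @\<^sub>v e) (r @\<^sub>v s)"
    using S' d k r sc ec s e_pos balance
    by (intro arithmetical_structure_prism) (auto simp: A)
  with e_pos balance show ?thesis by blast
qed

theorem theorem3p11:
  fixes m :: nat and d1 r1 :: "int vec"
  assumes "m \<ge> 2"
    and "arithmetical_structure (path_graph m) (path_order m) d1 r1"
  shows
    "arithmetical_structure (path_graph 2 \<box> path_graph m) (ladder_order m)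
       ((d1 + vec m (\<lambda>_. 1)) @\<^sub>v (d1 + vec m (\<lambda>_. 1))) (r1 @\<^sub>v r1) \<and>
     (\<forall>k r2 d2 A.
       A = adjacency_matrix (path_graph m) (path_order m) \<longrightarrow>
       k \<in> carrier_vec m \<longrightarrow> nonnegative_vec k \<longrightarrow>
       r2 = (diag_of_vec (d1 + k) - A) *\<^sub>v r1 \<longrightarrow>
       positive_vec r2 \<longrightarrow>
       (\<forall>i<m. r2 $ i dvd (A *\<^sub>v r2 + r1) $ i) \<longrightarrow>
       d2 = vec m (\<lambda>i. (A *\<^sub>v r2 + r1) $ i div r2 $ i) \<longrightarrow>
         positive_vec d2 \<and>
         (diag_of_vec d2 - A) *\<^sub>v r2 = r1 \<and>
         arithmetical_structure (path_graph 2 \<box> path_graph m) (ladder_order m)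
           ((d1 + k) @\<^sub>v d2) (r1 @\<^sub>v r2))"
proof -
  have len: "length (path_order m) = m" by (simp add: path_order_def)
  show ?thesis
    unfolding ladder_order_def
  proof (intro conjI allI impI)
    show "arithmetical_structure (path_graph 2 \<box> path_graph m)
        (List.product (path_order 2) (path_order m))
        ((d1 + vec m (\<lambda>_. 1)) @\<^sub>v (d1 + vec m (\<lambda>_. 1))) (r1 @\<^sub>v r1)"
      using arithmetical_structure_prism_doubling[OF assms(2)] by (simp only: len)
  qed (use arithmetical_structure_prism_extension[OF assms(2), unfolded len] in blast)+
qed

end
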